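(* Every online algorithm with advice for the general unbounded knapsack problem that reads fewer than $\log_2 n$ advice bits on instances of length $n$ has unbounded competitive ratio.
   Context: Online general unbounded knapsack problem: knapsack capacity $1$; an instance is a sequence of items $x_1,\dots,x_n$ ($n$ unknown to the algorithm), item $x_i$ having a size $s_i\in[0,1]$ and a value $v_i\ge0$. Items arrive one by one; upon arrival of $x_i$ the algorithm irrevocably chooses a number $k_i\in\mathbb{N}_0$ of copies to pack, with the total packed size never exceeding $1$. $\mathrm{opt}(I)=\max\{\sum_i k_i v_i: k_i\in\mathbb{N}_0,\sum_i k_i s_i\le1\}$; the (strict) competitive ratio is $\sup_I \mathrm{opt}(I)/\mathrm{gain}(I)$ where $\mathrm{gain}(I)$ is the total packed value. Advice model (tape model): an oracle knowing the whole instance writes an infinite binary advice string, which the deterministic online algorithm may read from the beginning; the algorithm uses $f(n)$ advice bits if on every instance with $n$ items it reads at most the first $f(n)$ bits. *)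

theory Defs
  imports Complex_Main "HOL-Library.Extended_Real"
begin

datatype item = Item (item_size: real) (item_value: real)

text \<open>A list \<open>ks\<close> gives the number of copies packed of each item, in order of arrival.\<close>

definition packed_size :: "item list \<Rightarrow> nat list \<Rightarrow> real" where
  "packed_size I ks = (\<Sum>i<length I. real (ks ! i) * item_size (I ! i))"

definition packed_value :: "item list \<Rightarrow> nat list \<Rightarrow> real" where
  "packed_value I ks = (\<Sum>i<length I. real (ks ! i) * item_value (I ! i))"

text \<open>Sizes are nonnegative, so bounding the final total size bounds it at all times.\<close>

definition packings :: "item list \<Rightarrow> nat list set" where
  "packings I = {ks. length ks = length I \<and> packed_size I ks \<le> 1}"

text \<open>The optimum is required to exist as a maximum. By \<open>knapsack_instance_iff\<close> below, this only
  excludes items of size zero and positive value. Such items would make the optimum infinite, and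
  every algorithm trivially non-competitive.\<close>

definition knapsack_instance :: "item list \<Rightarrow> bool" where
  "knapsack_instance I \<longleftrightarrow>
     (\<forall>x\<in>set I. 0 \<le> item_size x \<and> item_size x \<le> 1 \<and> 0 \<le> item_value x) \<and>
     (\<exists>ks\<in>packings I. \<forall>ls\<in>packings I. packed_value I ls \<le> packed_value I ks)"

definition opt :: "item list \<Rightarrow> real" where
  "opt I = Sup (packed_value I ` packings I)"

text \<open>A deterministic online algorithm is given by its next action, as a function of the items
  that have arrived so far (the last one being the current item) and the advice bits read so far:
  it either reads the next bit of the advice tape, or irrevocably packs some number of copies of
  the current item. Its own earlier decisions are determined by these data.\<close>

datatype action = Read | Pack nat

type_synonym online_alg = "item list \<Rightarrow> bool list \<Rightarrow> action"

type_synonym advice = "nat \<Rightarrow> bool"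

text \<open>\<open>run A t I ks r\<close>: with advice tape \<open>t\<close>, the algorithm processes all items of \<open>I\<close>, packs \<open>ks\<close>
  and has then read exactly the first \<open>r\<close> bits. There is no such \<open>ks\<close> and \<open>r\<close> if the algorithm
  reads forever on some item.\<close>

inductive run :: "online_alg \<Rightarrow> advice \<Rightarrow> item list \<Rightarrow> nat list \<Rightarrow> nat \<Rightarrow> bool"
  for A :: online_alg and t :: advice where
  run_Nil: "run A t [] [] 0"
| run_snoc: "run A t I ks r \<Longrightarrow> r \<le> r' \<Longrightarrow>
    (\<And>q. r \<le> q \<Longrightarrow> q < r' \<Longrightarrow> A (I @ [x]) (map t [0..<q]) = Read) \<Longrightarrow>
    A (I @ [x]) (map t [0..<r']) = Pack k \<Longrightarrow>
    run A t (I @ [x]) (ks @ [k]) r'"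

lemma run_deterministic:
  assumes "run A t I ks r" "run A t I ks' r'"
  shows "ks = ks' \<and> r = r'"
  using assms
proof (induction arbitrary: ks' r' rule: run.induct)
  case run_Nil
  then show ?case by (cases rule: run.cases) auto
next
  case (run_snoc I ks r r1 x k)
  from run_snoc.prems show ?case
  proof (cases rule: run.cases)
    case (run_snoc I' ls s y k')
    then have eq: "I' = I" "y = x" by auto
    with run_snoc run_snoc.IH have ih: "ls = ks" "s = r" by blast+
    have "r1 = r'"
    proof (cases r1 r' rule: linorder_cases)
      case less
      with run_snoc(5) eq ih run_snoc.hyps(2,4) show ?thesis
        by (metis action.distinct(1))
    next
      case greater
      with run_snoc(4,6) eq ih run_snoc.hyps(3) show ?thesis
        by (metis action.distinct(1))
    qed auto
    with run_snoc eq ih run_snoc.hyps show ?thesis by auto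
  qed auto
qed

text \<open>The oracle \<open>\<phi>\<close> maps each instance to the advice tape it writes for that instance.\<close>

type_synonym oracle_fun = "item list \<Rightarrow> advice"

definition solves_knapsack :: "online_alg \<Rightarrow> oracle_fun \<Rightarrow> bool" where
  "solves_knapsack A \<phi> \<longleftrightarrow>
     (\<forall>I. knapsack_instance I \<longrightarrow> (\<exists>ks r. run A (\<phi> I) I ks r \<and> ks \<in> packings I))"

definition bits_read :: "online_alg \<Rightarrow> oracle_fun \<Rightarrow> item list \<Rightarrow> nat" where
  "bits_read A \<phi> I = (THE r. \<exists>ks. run A (\<phi> I) I ks r)"

definition gain :: "online_alg \<Rightarrow> oracle_fun \<Rightarrow> item list \<Rightarrow> real" where
  "gain A \<phi> I = packed_value I (THE ks. \<exists>r. run A (\<phi> I) I ks r)"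

text \<open>In \<^typ>\<open>ereal\<close>, a positive number divided by \<open>0\<close> is \<open>\<infinity>\<close>, and \<open>0 / 0 = 0\<close>, so that instances
  with optimum \<open>0\<close> do not contribute.\<close>

definition competitive_ratio :: "online_alg \<Rightarrow> oracle_fun \<Rightarrow> ereal" where
  "competitive_ratio A \<phi> =
     (SUP I\<in>{I. knapsack_instance I}. ereal (opt I) / ereal (gain A \<phi> I))"

lemma knapsack_instance_iff:
  "knapsack_instance I \<longleftrightarrow>
     (\<forall>x\<in>set I. 0 \<le> item_size x \<and> item_size x \<le> 1 \<and> 0 \<le> item_value x \<and>
        (item_size x = 0 \<longrightarrow> item_value x = 0))"
  (is "?L \<longleftrightarrow> ?R")
proof
  assume L: ?L
  then obtain ks where ks: "ks \<in> packings I"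
    and max: "\<And>ls. ls \<in> packings I \<Longrightarrow> packed_value I ls \<le> packed_value I ks"
    unfolding knapsack_instance_def by blast
  have "item_value (I ! j) = 0" if j: "j < length I" and z: "item_size (I ! j) = 0" for j
  proof -
    define ls where "ls = ks[j := Suc (ks ! j)]"
    have len: "length ks = length I" using ks by (simp add: packings_def)
    have nth: "real (ls ! i) = real (ks ! i) + (if i = j then 1 else 0)" if "i < length I" for i
      using that len by (auto simp: ls_def nth_list_update)
    have "packed_size I ls = packed_size I ks"
      unfolding packed_size_def using z by (intro sum.cong) (auto simp: nth)
    then have "ls \<in> packings I" using ks by (simp add: packings_def ls_def)
    then have "packed_value I ls \<le> packed_value I ks" by (rule max)
    moreover have "packed_value I ls = packed_value I ks + item_value (I ! j)"
    proof -
      have "packed_value I ls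
          = (\<Sum>i<length I. real (ks ! i) * item_value (I ! i) + (if i = j then item_value (I ! i) else 0))"
        unfolding packed_value_def by (intro sum.cong) (auto simp: nth algebra_simps)
      then show ?thesis using j by (simp add: sum.distrib packed_value_def)
    qed
    moreover have "0 \<le> item_value (I ! j)" using L j by (simp add: knapsack_instance_def)
    ultimately show ?thesis by linarith
  qed
  then show ?R using L unfolding knapsack_instance_def by (metis in_set_conv_nth)
next
  assume R: ?R
  define N where "N = Max (insert 0 ((\<lambda>x. nat \<lfloor>1 / item_size x\<rfloor>) ` set I))"
  define B where "B = packed_value I ` {ks. set ks \<subseteq> {..N} \<and> length ks = length I}"
  have "finite B" unfolding B_def using finite_lists_length_eq[of "{..N}"] by simp
  have sub: "packed_value I ` packings I \<subseteq> B"
  proof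
    fix v assume "v \<in> packed_value I ` packings I"
    then obtain ks where ks: "length ks = length I" "packed_size I ks \<le> 1" "v = packed_value I ks"
      by (auto simp: packings_def)
    define ls where "ls = map (\<lambda>i. if item_size (I ! i) = 0 then 0 else ks ! i) [0..<length I]"
    have "packed_value I ls = v"
      unfolding ks packed_value_def using R by (intro sum.cong) (auto simp: ls_def)
    moreover have "set ls \<subseteq> {..N}"
    proof
      fix k assume "k \<in> set ls"
      then obtain i where i: "i < length I" "k = (if item_size (I ! i) = 0 then 0 else ks ! i)"
        by (auto simp: ls_def)
      show "k \<in> {..N}"
      proof (cases "item_size (I ! i) = 0")
        case False
        then have pos: "item_size (I ! i) > 0" using R i by (metis nth_mem order_le_less)
        have "real (ks ! i) * item_size (I ! i) \<le> packed_size I ks"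
          unfolding packed_size_def using R i
          by (intro member_le_sum) auto
        then have "real (ks ! i) \<le> 1 / item_size (I ! i)"
          using ks pos by (simp add: field_simps)
        then have "ks ! i \<le> nat \<lfloor>1 / item_size (I ! i)\<rfloor>" by linarith
        also have "\<dots> \<le> N" unfolding N_def using i by (intro Max_ge) auto
        finally show ?thesis using i False by simp
      qed (use i in simp)
    qed
    ultimately show "v \<in> B" unfolding B_def by (force simp: ls_def)
  qed
  have fin: "finite (packed_value I ` packings I)" using sub \<open>finite B\<close> by (rule finite_subset)
  have "replicate (length I) 0 \<in> packings I" by (simp add: packings_def packed_size_def)
  then have "Max (packed_value I ` packings I) \<in> packed_value I ` packings I"
    using fin by (intro Max_in) auto
  then obtain ks where "ks \<in> packings I" "packed_value I ks = Max (packed_value I ` packings I)"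
    by auto
  then have "\<exists>ks\<in>packings I. \<forall>ls\<in>packings I. packed_value I ls \<le> packed_value I ks"
    using fin by (intro bexI[of _ ks]) auto
  then show ?L using R by (simp add: knapsack_instance_def)
qed

end

theory Submission imports Defs begin

text \<open>All items have size \<open>1\<close>, so a packing contains at most one item. For \<open>j < n\<close> the instance
  \<open>I\<^sub>j\<close> offers the values \<open>1, M, \<dots>, M ^ j\<close> followed by worthless items, and every packing that misses
  item \<open>j\<close> is worse than the optimum by a factor of at least \<open>M\<close>. With fewer than \<open>log\<^sub>2 n\<close> advice bits,
  two instances \<open>I\<^sub>i\<close> and \<open>I\<^sub>j\<close>, \<open>i < j\<close>, receive the same advice. They agree on the first \<open>i + 1\<close>
  items, so the algorithm cannot both take item \<open>i\<close> of \<open>I\<^sub>i\<close> and item \<open>j\<close> of \<open>I\<^sub>j\<close>.\<close>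

subsection \<open>Runs of online algorithms with advice\<close>

lemma run_length: "run A t I ks r \<Longrightarrow> length ks = length I"
  by (induction rule: run.induct) auto

text \<open>This is where the online character enters: \<open>A\<close> sees only the items that
  have arrived, so dropping later items drops only the last steps of a run. The tape is read
  forwards, hence \<open>r' \<le> r\<close>.\<close>

lemma run_take:
  "run A t I ks r \<Longrightarrow> \<exists>r'\<le>r. run A t (take m I) (take m ks) r'"
proof (induction rule: run.induct)
  case run_Nil
  show ?case by (auto intro: run.run_Nil)
next
  case (run_snoc I ks r r' x k)
  have len: "length ks = length I" using run_snoc.hyps(1) by (rule run_length)
  show ?case
  proof (cases "m \<le> length I")
    case True
    with run_snoc.IH run_snoc.hyps(2) len show ?thesis by (auto intro: order_trans)
  next
    case False
    with run.run_snoc[OF run_snoc.hyps] len show ?thesis by auto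
  qed
qed

lemma run_cong_tape:
  assumes "run A t I ks r" and "map t [0..<b] = map t' [0..<b]" and "r \<le> b"
  shows "run A t' I ks r"
  using assms(1,3)
proof (induction rule: run.induct)
  case run_Nil
  show ?case by (rule run.run_Nil)
next
  case (run_snoc I ks r r' x k)
  have eq: "map t' [0..<q] = map t [0..<q]" if "q \<le> r'" for q
    using assms(2) run_snoc.prems that by (auto simp: map_eq_conv)
  show ?case
    by (rule run.run_snoc[where r = r], rule run_snoc.IH)
      (use run_snoc.hyps(2-4) run_snoc.prems in \<open>simp_all add: eq del: map_eq_conv\<close>)
qed

lemma bits_read_eq: "run A (\<phi> I) I ks r \<Longrightarrow> bits_read A \<phi> I = r"
  unfolding bits_read_def by (rule the_equality) (blast dest: run_deterministic)+

lemma gain_eq: "run A (\<phi> I) I ks r \<Longrightarrow> gain A \<phi> I = packed_value I ks"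
  unfolding gain_def
  by (rule arg_cong[where f = "packed_value I"], rule the_equality) (blast dest: run_deterministic)+

text \<open>Only the run on \<open>I\<close> needs its bits bounded by \<open>b\<close>; the run on
  \<open>J\<close> may read more. The truncated run on \<open>I\<close> is also a run with tape
  \<open>t'\<close>, and determinism then identifies it with the truncated run on
  \<open>J\<close>.\<close>

lemma run_same_decisions:
  assumes "run A t I ks r" "run A t' J ls s"
    and "map t [0..<b] = map t' [0..<b]" "r \<le> b" "take m I = take m J"
  shows "take m ks = take m ls"
proof -
  obtain r' where r': "r' \<le> r" "run A t (take m I) (take m ks) r'"
    using run_take[OF assms(1)] by blast
  obtain s' where s': "run A t' (take m J) (take m ls) s'"
    using run_take[OF assms(2)] by blast
  have "run A t' (take m I) (take m ks) r'"
    using run_cong_tape[OF r'(2) assms(3)] r'(1) assms(4) by simp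
  with s' show ?thesis unfolding assms(5) by (blast dest: run_deterministic)
qed

lemma two_instances_same_advice:
  fixes I :: "nat \<Rightarrow> item list"
  assumes "n > 0" and "\<And>j. j < n \<Longrightarrow> real (bits_read A \<phi> (I j)) < log 2 (real n)"
  obtains i j b where "i < j" "j < n" "bits_read A \<phi> (I i) \<le> b"
    "map (\<phi> (I i)) [0..<b] = map (\<phi> (I j)) [0..<b]"
proof -
  \<comment> \<open>Taking the maximum gives all \<open>n\<close> instances one common prefix
    length, so that the pigeonhole principle applies: \<open>2 ^ b < n\<close> leaves fewer prefixes
    than instances.\<close>
  define b where "b = Max ((\<lambda>j. bits_read A \<phi> (I j)) ` {..<n})"
  have "b \<in> (\<lambda>j. bits_read A \<phi> (I j)) ` {..<n}"
    unfolding b_def using assms(1) by (intro Max_in) auto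
  then have "real b < log 2 (real n)" using assms(2) by auto
  then have "2 powr real b < real n" using assms(1) by (simp add: less_log_iff)
  then have "(2::real) ^ b < real n" by (simp add: powr_realpow)
  then have pow: "2 ^ b < n" by (metis of_nat_less_iff of_nat_numeral of_nat_power)
  define T where "T = {bs :: bool list. set bs \<subseteq> UNIV \<and> length bs = b}"
  have T: "finite T" "card T = 2 ^ b"
    unfolding T_def by (rule finite_lists_length_eq, simp, subst card_lists_length_eq, simp_all)
  let ?f = "\<lambda>j. map (\<phi> (I j)) [0..<b]"
  have "card (?f ` {..<n}) \<le> card T"
    using T(1) by (intro card_mono) (auto simp: T_def)
  then have "\<not> inj_on ?f {..<n}"
    using pow T(2) by (intro pigeonhole) simp
  then obtain i j where ij: "i < n" "j < n" "i \<noteq> j" "?f i = ?f j"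
    unfolding inj_on_def by auto
  have le: "bits_read A \<phi> (I k) \<le> b" if "k < n" for k
    unfolding b_def using that by (intro Max_ge) auto
  show ?thesis
  proof (cases "i < j")
    case True
    then show ?thesis using that[of i j b] ij le by auto
  next
    case False
    then show ?thesis using that[of j i b] ij le by auto
  qed
qed

lemma packed_value_le_opt:
  assumes "knapsack_instance I" "ks \<in> packings I"
  shows "packed_value I ks \<le> opt I"
  unfolding opt_def
  using assms by (intro cSup_upper) (auto simp: knapsack_instance_def bdd_above_def)

lemma ereal_le_divide:
  assumes "0 < p" "0 \<le> g" "c * g \<le> p"
  shows "ereal c \<le> ereal p / ereal g"
\<comment> \<open>For \<open>g = 0\<close> the quotient is infinite, because \<open>p\<close> is
  positive.\<close>
proof (cases "g = 0")
  case False
  with assms show ?thesis by (simp add: pos_le_divide_eq)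
qed (use assms in \<open>simp add: divide_ereal_def\<close>)

subsection \<open>The hard instances\<close>

text \<open>The padding with worthless items gives all these instances the same length
  \<open>n\<close>, so one advice bound covers them all.\<close>

definition hard_instance :: "real \<Rightarrow> nat \<Rightarrow> nat \<Rightarrow> item list" where
  "hard_instance M n j = map (\<lambda>i. Item 1 (if i \<le> j then M ^ i else 0)) [0..<n]"

lemma length_hard_instance [simp]: "length (hard_instance M n j) = n"
  by (simp add: hard_instance_def)

lemma nth_hard_instance [simp]:
  "i < n \<Longrightarrow> hard_instance M n j ! i = Item 1 (if i \<le> j then M ^ i else 0)"
  by (simp add: hard_instance_def)

lemma knapsack_hard_instance: "0 \<le> M \<Longrightarrow> knapsack_instance (hard_instance M n j)"
  by (auto simp: knapsack_instance_iff hard_instance_def)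

lemma take_hard_instance:
  "i \<le> j \<Longrightarrow> take (Suc i) (hard_instance M n i) = take (Suc i) (hard_instance M n j)"
  by (rule nth_equalityI) auto

lemma packings_hard_instance:
  "ks \<in> packings (hard_instance M n j) \<longleftrightarrow> length ks = n \<and> (\<Sum>i<n. ks ! i) \<le> 1"
proof -
  have "packed_size (hard_instance M n j) ks = real (\<Sum>i<n. ks ! i)"
    by (simp add: packed_size_def)
  then show ?thesis by (auto simp: packings_def simp del: of_nat_sum)
qed

lemma opt_hard_instance_ge:
  assumes "0 \<le> M" "j < n"
  shows "M ^ j \<le> opt (hard_instance M n j)"
proof -
  let ?ks = "(replicate n 0)[j := Suc 0]"
  have nth: "?ks ! i = (if i = j then 1 else 0)" if "i < n" for i
    using that by (auto simp: nth_list_update)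
  have "?ks \<in> packings (hard_instance M n j)"
    using assms by (simp add: packings_hard_instance nth)
  moreover have "packed_value (hard_instance M n j) ?ks = (\<Sum>i<n. if i = j then M ^ j else 0)"
    unfolding packed_value_def by (rule sum.cong) (auto simp: nth)
  then have "packed_value (hard_instance M n j) ?ks = M ^ j" using assms by simp
  ultimately show ?thesis
    using packed_value_le_opt[OF knapsack_hard_instance[OF assms(1)]] by metis
qed

lemma packed_value_hard_instance_le:
  assumes "1 \<le> M" "ks \<in> packings (hard_instance M n j)" "ks ! j = 0"
  shows "M * packed_value (hard_instance M n j) ks \<le> M ^ j"
proof -
  let ?v = "\<lambda>i. if i \<le> j then M ^ i else 0"
  \<comment> \<open>For \<open>i < j\<close> this is \<open>M ^ Suc i \<le> M ^ j\<close>; for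
    \<open>i > j\<close> the value is 0. Keeping the factor \<open>M\<close> on the left avoids the
    exponent \<open>j - 1\<close>, which would go wrong at \<open>j = 0\<close>.\<close>
  have v: "M * ?v i \<le> M ^ j" if "i \<noteq> j" for i
    using assms(1) that power_increasing[of "Suc i" j M] by auto
  have "M * packed_value (hard_instance M n j) ks = (\<Sum>i<n. real (ks ! i) * (M * ?v i))"
    by (auto simp: packed_value_def sum_distrib_left intro!: sum.cong)
  also have "\<dots> \<le> (\<Sum>i<n. real (ks ! i) * M ^ j)"
  proof (rule sum_mono)
    fix i
    show "real (ks ! i) * (M * ?v i) \<le> real (ks ! i) * M ^ j"
      using v[of i] assms(3) by (cases "i = j") (auto intro: mult_left_mono)
  qed
  also have "\<dots> = real (\<Sum>i<n. ks ! i) * M ^ j" by (simp add: sum_distrib_right)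
  also have "\<dots> \<le> 1 * M ^ j"
    using assms(1,2) by (intro mult_right_mono) (auto simp: packings_hard_instance simp del: of_nat_sum)
  finally show ?thesis by simp
qed

lemma hard_instance_missed:
  assumes solves: "solves_knapsack A \<phi>" and "0 \<le> M" "n > 0"
    and bits: "\<And>j. j < n \<Longrightarrow> real (bits_read A \<phi> (hard_instance M n j)) < log 2 (real n)"
  obtains j ks r where "j < n" "run A (\<phi> (hard_instance M n j)) (hard_instance M n j) ks r"
    "ks \<in> packings (hard_instance M n j)" "ks ! j = 0"
proof -
  let ?I = "hard_instance M n"
  obtain i j b where ij: "i < j" "j < n" and b: "bits_read A \<phi> (?I i) \<le> b"
    and advice: "map (\<phi> (?I i)) [0..<b] = map (\<phi> (?I j)) [0..<b]"
    by (rule two_instances_same_advice[OF \<open>n > 0\<close> bits])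
  have "\<exists>ks r. run A (\<phi> (?I k)) (?I k) ks r \<and> ks \<in> packings (?I k)" for k
    using solves knapsack_hard_instance[OF \<open>0 \<le> M\<close>] by (simp add: solves_knapsack_def)
  then obtain ks r ls s where ks: "run A (\<phi> (?I i)) (?I i) ks r" "ks \<in> packings (?I i)"
    and ls: "run A (\<phi> (?I j)) (?I j) ls s" "ls \<in> packings (?I j)"
    by meson
  have "r \<le> b" using bits_read_eq[where \<phi> = \<phi>, OF ks(1)] b by simp
  with ks(1) ls(1) advice have "take (Suc i) ks = take (Suc i) ls"
    by (rule run_same_decisions) (use ij in \<open>simp add: take_hard_instance\<close>)
  then have same: "ks ! i = ls ! i" by (metis lessI nth_take)
  \<comment> \<open>On \<open>?I j\<close> there is room for a single item. If the shared decision
    packs item \<open>i\<close>, then item \<open>j\<close> of \<open>?I j\<close> is missed;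
    otherwise item \<open>i\<close> of \<open>?I i\<close> is missed.\<close>
  have "ls ! i + ls ! j = (\<Sum>k\<in>{i, j}. ls ! k)" using ij by simp
  also have "\<dots> \<le> (\<Sum>k<n. ls ! k)" using ij by (intro sum_mono2) auto
  also have "\<dots> \<le> 1" using ls(2) by (simp add: packings_hard_instance)
  finally consider "ks ! i = 0" | "ls ! j = 0" using same by linarith
  then show ?thesis
  proof cases
    case 1
    then show ?thesis using that[OF _ ks] ij by simp
  next
    case 2
    then show ?thesis using that[OF _ ls] ij by simp
  qed
qed

theorem theorem9:
  fixes A :: online_alg and \<phi> :: oracle_fun and n :: nat
  assumes "solves_knapsack A \<phi>"
    and "\<And>I. knapsack_instance I \<Longrightarrow> length I = n \<Longrightarrow> real (bits_read A \<phi> I) < log 2 (real n)"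
  shows "competitive_ratio A \<phi> = \<infinity>"
proof -
  \<comment> \<open>For \<open>n = 0\<close> the bound would be \<open>log 2 0\<close>, which is 0
    by convention, and no number of bits lies below it.\<close>
  have n: "n > 0"
  proof (rule ccontr)
    assume "\<not> n > 0"
    then show False
      using assms(2)[of "[]"] by (simp add: knapsack_instance_iff log_def)
  qed
  have ratio: "ereal M \<le> competitive_ratio A \<phi>" if M: "1 \<le> M" for M
  proof -
    let ?I = "hard_instance M n"
    have inst: "knapsack_instance (?I j)" for j using M by (intro knapsack_hard_instance) simp
    obtain j ks r where j: "j < n" and run: "run A (\<phi> (?I j)) (?I j) ks r"
      and ks: "ks \<in> packings (?I j)" "ks ! j = 0"
      using hard_instance_missed[of A \<phi> M n] assms inst n M by auto
    have "gain A \<phi> (?I j) = packed_value (?I j) ks"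
      using run by (rule gain_eq)
    moreover have "0 \<le> packed_value (?I j) ks"
      unfolding packed_value_def using M by (intro sum_nonneg) auto
    moreover have "M ^ j \<le> opt (?I j)" using M j by (intro opt_hard_instance_ge) auto
    moreover have "0 < M ^ j" using M by simp
    moreover note packed_value_hard_instance_le[OF M ks]
    ultimately have "ereal M \<le> ereal (opt (?I j)) / ereal (gain A \<phi> (?I j))"
      by (intro ereal_le_divide) auto
    also have "\<dots> \<le> competitive_ratio A \<phi>"
      unfolding competitive_ratio_def using inst by (intro SUP_upper) simp
    finally show ?thesis .
  qed
  show ?thesis
  proof (rule ereal_top)
    fix B :: real
    \<comment> \<open>The bound \<open>ratio\<close> needs \<open>1 \<le> M\<close>, hence the
      maximum with 1.\<close>
    have "ereal B \<le> ereal (max 1 B)" by simp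
    also have "\<dots> \<le> competitive_ratio A \<phi>" by (rule ratio) simp
    finally show "ereal B \<le> competitive_ratio A \<phi>" .
  qed
qed

end
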